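(* Let $\varepsilon>0$, let condition (N) hold for $(b_{ij})$, and consider densities $\rho_1^\varepsilon,\dots,\rho_n^\varepsilon>0$ and a velocity $v^\varepsilon$ (functions of $(x,t)$, $x\in\mathbb R^3$, sufficiently smooth), with $\rho^\varepsilon=\sum_{i=1}^n\rho_i^\varepsilon$. The system $$\partial_t\rho_i^\varepsilon+\operatorname{div}(\rho_i^\varepsilon v^\varepsilon)=-\operatorname{div}(\rho_i^\varepsilon u_i^\varepsilon),\qquad\partial_t(\rho^\varepsilon v^\varepsilon)+\operatorname{div}(\rho^\varepsilon v^\varepsilon\otimes v^\varepsilon)=-\sum_{i=1}^n\rho_i^\varepsilon\nabla\frac{\delta\mathcal E}{\delta\rho_i}(\boldsymbol\rho^\varepsilon),\qquad i=1,\dots,n,$$ where $(u_1^\varepsilon,\dots,u_n^\varepsilon)$ is the unique solution of $$-\sum_{j=1}^nb_{ij}\rho_i^\varepsilon\rho_j^\varepsilon(u_i^\varepsilon-u_j^\varepsilon)=\varepsilon d_i^\varepsilon\ (i=1,\dots,n),\qquad\sum_{j=1}^n\rho_j^\varepsilon u_j^\varepsilon=0,\qquad d_i^\varepsilon=-\frac{\rho_i^\varepsilon}{\rho^\varepsilon}\sum_{j=1}^n\rho_j^\varepsilon\nabla\frac{\delta\mathcal E}{\delta\rho_j}(\boldsymbol\rho^\varepsilon)+\rho_i^\varepsilon\nabla\frac{\delta\mathcal E}{\delta\rho_i}(\boldsymbol\rho^\varepsilon),$$ can be rewritten as $$\partial_t\rho_i^\varepsilon+\operatorname{div}(\rho_i^\varepsilon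 v^\varepsilon)=\varepsilon\operatorname{div}\sum_{j=1}^nD_{ij}^\varepsilon\nabla\frac{\delta\mathcal E}{\delta\rho_j}(\boldsymbol\rho^\varepsilon),\qquad\partial_t(\rho^\varepsilon v^\varepsilon)+\operatorname{div}(\rho^\varepsilon v^\varepsilon\otimes v^\varepsilon)=-\sum_{i=1}^n\rho_i^\varepsilon\nabla\frac{\delta\mathcal E}{\delta\rho_i}(\boldsymbol\rho^\varepsilon),\qquad i=1,\dots,n,$$ where $$D^\varepsilon=G(Q^\varepsilon)^{-1}(\tau^\varepsilon)^{-1}(Q^\varepsilon)^{-1}G^\top\in\mathbb R^{n\times n},$$ with $(Q^\varepsilon)^{-1}\in\mathbb R^{(n-1)\times(n-1)}$ having the coefficients $(Q^\varepsilon)^{-1}_{ij}=\delta_{ij}\rho_i^\varepsilon-\rho_i^\varepsilon\rho_j^\varepsilon/\rho^\varepsilon$, with $(\tau^\varepsilon)^{-1}$ the inverse of the $(n-1)\times(n-1)$ matrix $\tau^\varepsilon$ defined in the context, and with $G=(G_{ij})\in\mathbb R^{n\times(n-1)}$ defined by $G_{ii}=1$, $G_{ni}=-1$ for $i=1,\dots,n-1$ and $G_{ij}=0$ elsewhere.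
   Context: $\boldsymbol\rho=(\rho_1,\dots,\rho_n)$; $\mathcal E(\boldsymbol\rho)=\int_{\mathbb R^3}\sum_{i=1}^nF_i(\rho_i,\nabla\rho_i)dx$ is the potential energy, $\frac{\delta\mathcal E}{\delta\rho_i}(\boldsymbol\rho)=\frac{\partial F_i}{\partial\rho_i}(\rho_i,\nabla\rho_i)-\operatorname{div}\frac{\partial F_i}{\partial q_i}(\rho_i,\nabla\rho_i)$ its variational derivative ($F_i=F_i(\rho_i,q_i)$). Condition (N): $(b_{ij})\in\mathbb R^{n\times n}$ is symmetric with $b_{ij}\ge0$, and for any $\rho_1,\dots,\rho_n>0$ the linear system $\sum_{j=1}^nb_{ij}\rho_i\rho_j(v_i-v_j)=0$, $i=1,\dots,n$, has the one-dimensional null space $\operatorname{span}\{(1,\dots,1)\}$. Matrix $\tau^\varepsilon$: the $n\times n$ matrix with coefficients $\tau_{ij}^\varepsilon=\delta_{ij}\sum_{k=1}^nb_{ik}\rho_i^\varepsilon\rho_k^\varepsilon-b_{ij}\rho_i^\varepsilon\rho_j^\varepsilon$ has rank $n-1$; after reordering of the indices if necessary, its submatrix $\tau^\varepsilon=(\tau_{ij}^\varepsilon)_{i,j=1,\dots,n-1}$ is invertible, and $(\tau^\varepsilon)^{-1}$ denotes the inverse of this submatrix. *)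

theory Defs
  imports
    "HOL-Analysis.Analysis"
    "Jordan_Normal_Form.Gauss_Jordan_Elimination"
begin

text \<open>
  The species are indexed by \<open>0, \<dots>, n - 1\<close>, so the distinguished last species is \<open>n - 1\<close>.
  Space-time dependent fields take the time first: \<open>\<rho> i t x\<close> and \<open>v t x\<close>.
\<close>

definition grad :: "('a::euclidean_space \<Rightarrow> real) \<Rightarrow> 'a \<Rightarrow> 'a" where
  "grad f x = (\<Sum>e\<in>Basis. frechet_derivative f (at x) e *\<^sub>R e)"

definition divergence :: "('a::euclidean_space \<Rightarrow> 'a) \<Rightarrow> 'a \<Rightarrow> real" where
  "divergence f x = (\<Sum>e\<in>Basis. inner (frechet_derivative f (at x) e) e)"

text \<open>Row-wise divergence of the tensor field \<open>m \<otimes> w\<close>: the component in direction \<open>e\<close> is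
  \<open>div (m\<^sub>e w)\<close>.\<close>

definition div_tensor ::
    "('a::euclidean_space \<Rightarrow> 'a) \<Rightarrow> ('a \<Rightarrow> 'a) \<Rightarrow> 'a \<Rightarrow> 'a" where
  "div_tensor m w x = (\<Sum>e\<in>Basis. divergence (\<lambda>y. inner (m y) e *\<^sub>R w y) x *\<^sub>R e)"

text \<open>\<open>k\<close>-fold continuous differentiability; meant for open sets \<open>S\<close>.\<close>

primrec Ck_on ::
    "nat \<Rightarrow> ('a::euclidean_space \<Rightarrow> 'b::euclidean_space) \<Rightarrow> 'a set \<Rightarrow> bool" where
  "Ck_on 0 f S \<longleftrightarrow> continuous_on S f"
| "Ck_on (Suc k) f S \<longleftrightarrow>
     (\<forall>x\<in>S. f differentiable (at x)) \<and>
     (\<forall>e\<in>Basis. Ck_on k (\<lambda>x. frechet_derivative f (at x) e) S)"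

text \<open>The variational derivative of \<open>r \<mapsto> \<integral> f (r, \<nabla>r) dx\<close> for a single density \<open>r\<close>.\<close>

definition var_deriv ::
    "(real \<Rightarrow> 'a::euclidean_space \<Rightarrow> real) \<Rightarrow> ('a \<Rightarrow> real) \<Rightarrow> 'a \<Rightarrow> real" where
  "var_deriv f r x =
     deriv (\<lambda>s. f s (grad r x)) (r x) - divergence (\<lambda>y. grad (f (r y)) (grad r y)) x"

definition condition_N :: "nat \<Rightarrow> real mat \<Rightarrow> bool" where
  "condition_N n b \<longleftrightarrow>
     b \<in> carrier_mat n n \<and> transpose_mat b = b \<and> (\<forall>i<n. \<forall>j<n. b $$ (i, j) \<ge> 0) \<and>
     (\<forall>r :: nat \<Rightarrow> real. (\<forall>i<n. r i > 0) \<longrightarrow>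
        {w \<in> carrier_vec n.
           \<forall>i<n. (\<Sum>j<n. b $$ (i, j) * r i * r j * (vec_index w i - vec_index w j)) = 0}
        = range (\<lambda>c. c \<cdot>\<^sub>v Matrix.vec n (\<lambda>_. 1)))"

definition tau_full :: "nat \<Rightarrow> real mat \<Rightarrow> (nat \<Rightarrow> real) \<Rightarrow> real mat" where
  "tau_full n b r = mat n n (\<lambda>(i, j).
     (if i = j then \<Sum>k<n. b $$ (i, k) * r i * r k else 0) - b $$ (i, j) * r i * r j)"

text \<open>Under condition (N) and for positive \<open>r\<close> the block belonging to the first \<open>n - 1\<close> species is
  always invertible, so the species need no reordering.\<close>

definition tau_mat :: "nat \<Rightarrow> real mat \<Rightarrow> (nat \<Rightarrow> real) \<Rightarrow> real mat" where
  "tau_mat n b r = mat (n - 1) (n - 1) (\<lambda>ij. tau_full n b r $$ ij)"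

text \<open>\<open>Q\<^sup>-\<^sup>1\<close> is given by its entries; the sum runs over all \<open>n\<close> species, although the matrix has size
  \<open>n - 1\<close>.\<close>

definition Qinv_mat :: "nat \<Rightarrow> (nat \<Rightarrow> real) \<Rightarrow> real mat" where
  "Qinv_mat n r = mat (n - 1) (n - 1) (\<lambda>(i, j).
     (if i = j then r i else 0) - r i * r j / (\<Sum>k<n. r k))"

definition G_mat :: "nat \<Rightarrow> real mat" where
  "G_mat n = mat n (n - 1) (\<lambda>(i, j). if i = j then 1 else if i = n - 1 then - 1 else 0)"

definition D_mat :: "nat \<Rightarrow> real mat \<Rightarrow> (nat \<Rightarrow> real) \<Rightarrow> real mat" where
  "D_mat n b r =
     G_mat n * Qinv_mat n r * the (mat_inverse (tau_mat n b r)) * Qinv_mat n r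
       * transpose_mat (G_mat n)"

text \<open>Here \<open>r\<close> and \<open>g\<close> are the values at one point of the densities and of the gradients of the
  variational derivatives.\<close>

definition driving_force ::
    "nat \<Rightarrow> (nat \<Rightarrow> real) \<Rightarrow> (nat \<Rightarrow> 'a::real_vector) \<Rightarrow> nat \<Rightarrow> 'a" where
  "driving_force n r g i =
     - ((r i / (\<Sum>k<n. r k)) *\<^sub>R (\<Sum>j<n. r j *\<^sub>R g j)) + r i *\<^sub>R g i"

text \<open>Restricting to \<^term>\<open>extensional {..<n}\<close> makes a function on the naturals represent an
  \<open>n\<close>-tuple, so that uniqueness is meaningful.\<close>

definition solves_rel_velocity ::
    "nat \<Rightarrow> real mat \<Rightarrow> real \<Rightarrow> (nat \<Rightarrow> real) \<Rightarrow> (nat \<Rightarrow> 'a::real_vector) \<Rightarrow> (nat \<Rightarrow> 'a) \<Rightarrow> bool"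
  where
  "solves_rel_velocity n b \<epsilon> r g u \<longleftrightarrow>
     u \<in> extensional {..<n} \<and>
     (\<forall>i<n. - (\<Sum>j<n. (b $$ (i, j) * r i * r j) *\<^sub>R (u i - u j))
              = \<epsilon> *\<^sub>R driving_force n r g i) \<and>
     (\<Sum>j<n. r j *\<^sub>R u j) = 0"

definition rel_velocity ::
    "nat \<Rightarrow> real mat \<Rightarrow> real \<Rightarrow> (nat \<Rightarrow> real) \<Rightarrow> (nat \<Rightarrow> 'a::real_vector) \<Rightarrow> nat \<Rightarrow> 'a" where
  "rel_velocity n b \<epsilon> r g = (THE u. solves_rel_velocity n b \<epsilon> r g u)"

definition grad_var ::
    "(nat \<Rightarrow> real \<Rightarrow> 'a::euclidean_space \<Rightarrow> real) \<Rightarrow> (nat \<Rightarrow> real \<Rightarrow> 'a \<Rightarrow> real)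
       \<Rightarrow> real \<Rightarrow> 'a \<Rightarrow> nat \<Rightarrow> 'a" where
  "grad_var F \<rho> t x i = grad (var_deriv (F i) (\<rho> i t)) x"

definition momentum_equation ::
    "nat \<Rightarrow> (nat \<Rightarrow> real \<Rightarrow> 'a::euclidean_space \<Rightarrow> real) \<Rightarrow> (nat \<Rightarrow> real \<Rightarrow> 'a \<Rightarrow> real)
       \<Rightarrow> (real \<Rightarrow> 'a \<Rightarrow> 'a) \<Rightarrow> real \<Rightarrow> 'a \<Rightarrow> bool" where
  "momentum_equation n F \<rho> v t x \<longleftrightarrow>
     vector_derivative (\<lambda>s. (\<Sum>i<n. \<rho> i s x) *\<^sub>R v s x) (at t)
       + div_tensor (\<lambda>y. (\<Sum>i<n. \<rho> i t y) *\<^sub>R v t y) (v t) x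
     = - (\<Sum>i<n. \<rho> i t x *\<^sub>R grad_var F \<rho> t x i)"

definition relative_velocity_system ::
    "nat \<Rightarrow> real mat \<Rightarrow> real \<Rightarrow> (nat \<Rightarrow> real \<Rightarrow> 'a::euclidean_space \<Rightarrow> real) \<Rightarrow> real set
       \<Rightarrow> (nat \<Rightarrow> real \<Rightarrow> 'a \<Rightarrow> real) \<Rightarrow> (real \<Rightarrow> 'a \<Rightarrow> 'a) \<Rightarrow> bool" where
  "relative_velocity_system n b \<epsilon> F I \<rho> v \<longleftrightarrow>
     (\<forall>t\<in>I. \<forall>x.
        (\<forall>i<n. deriv (\<lambda>s. \<rho> i s x) t + divergence (\<lambda>y. \<rho> i t y *\<^sub>R v t y) x
           = - divergence
                 (\<lambda>y. \<rho> i t y *\<^sub>R rel_velocity n b \<epsilon> (\<lambda>k. \<rho> k t y) (grad_var F \<rho> t y) i) x) \<and>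
        momentum_equation n F \<rho> v t x)"

definition diffusion_system ::
    "nat \<Rightarrow> real mat \<Rightarrow> real \<Rightarrow> (nat \<Rightarrow> real \<Rightarrow> 'a::euclidean_space \<Rightarrow> real) \<Rightarrow> real set
       \<Rightarrow> (nat \<Rightarrow> real \<Rightarrow> 'a \<Rightarrow> real) \<Rightarrow> (real \<Rightarrow> 'a \<Rightarrow> 'a) \<Rightarrow> bool" where
  "diffusion_system n b \<epsilon> F I \<rho> v \<longleftrightarrow>
     (\<forall>t\<in>I. \<forall>x.
        (\<forall>i<n. deriv (\<lambda>s. \<rho> i s x) t + divergence (\<lambda>y. \<rho> i t y *\<^sub>R v t y) x
           = \<epsilon> * divergence
                 (\<lambda>y. \<Sum>j<n. D_mat n b (\<lambda>k. \<rho> k t y) $$ (i, j) *\<^sub>R grad_var F \<rho> t y j) x) \<and>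
        momentum_equation n F \<rho> v t x)"

end

theory Submission
  imports Defs "Jordan_Normal_Form.Determinant"
begin

text \<open>
  The momentum equations of the two systems coincide, so everything rests on the pointwise identity
  of fluxes \<open>\<rho>\<^sub>i u\<^sub>i = - \<epsilon> \<Sum>\<^sub>j D\<^sub>i\<^sub>j \<nabla>(\<delta>E/\<delta>\<rho>\<^sub>j)\<close>. The friction term of species \<open>i\<close> is row \<open>i\<close> of the full
  matrix \<open>\<tau>\<close> applied to the velocities. The rows of \<open>\<tau>\<close> sum to zero, so only the differences
  \<open>u\<^sub>j - u\<^sub>n\<close> enter; its columns sum to zero by symmetry, and so do the driving forces, so the last
  balance equation follows from the others. What remains is a square system for the \<open>n - 1\<close>
  differences, whose matrix is invertible: a vector in its kernel, extended by zero, lies in the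
  kernel of the full matrix, hence is constant by condition (N), hence zero. The constraint
  \<open>\<Sum>\<^sub>j \<rho>\<^sub>j u\<^sub>j = 0\<close> then fixes \<open>u\<^sub>n\<close>, which gives existence and uniqueness
  (\<open>balance_iff_reduced\<close>, \<open>velocity_from_differences\<close>).

  The factorization of \<open>D\<close> reads off this solution procedure from right to left: \<open>Q\<^sup>-\<^sup>1 G\<^sup>T\<close> turns the
  gradients into the driving forces of the first \<open>n - 1\<close> species, \<open>\<tau>\<^sup>-\<^sup>1\<close> solves for the velocity
  differences, and \<open>G Q\<^sup>-\<^sup>1\<close> turns differences into the fluxes \<open>\<rho>\<^sub>i u\<^sub>i\<close> of all species
  (\<open>Qinv_G_transpose_act\<close>, \<open>G_Qinv_act\<close>).

  To pull the factor \<open>\<epsilon>\<close> out of the divergence, the flux must be differentiable, because a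
  Frechet derivative at a point of non-differentiability is an arbitrary value that need not scale.
  The variational derivative costs two orders of smoothness (\<open>Ck_on_var_deriv\<close>) and the outer
  gradient one more, so four orders for \<open>F\<^sub>j\<close> and \<open>\<rho>\<^sub>j\<close> leave the gradient differentiable; the
  entries of \<open>D\<close> are differentiable because the inverse of a matrix is its adjugate divided by its
  determinant (\<open>entries_differentiable_inverse\<close>).
\<close>

section \<open>Calculus of k-times continuously differentiable maps\<close>

lemma Ck_on_Suc_has_derivative:
  assumes "Ck_on (Suc k) f S" "x \<in> S"
  shows "(f has_derivative frechet_derivative f (at x)) (at x)"
proof -
  have "f differentiable (at x)"
    using assms unfolding Ck_on.simps by blast
  then show ?thesis
    by (rule frechet_derivative_works[THEN iffD1])
qed

lemma Ck_on_cong: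
  assumes "open S" "\<And>x. x \<in> S \<Longrightarrow> f x = g x" "Ck_on k f S"
  shows "Ck_on k g S"
  using assms(2,3)
proof (induction k arbitrary: f g)
  case 0
  then show ?case using continuous_on_cong[of S S f g] by simp
next
  case (Suc k)
  have deriv: "(g has_derivative frechet_derivative f (at x)) (at x)" if "x \<in> S" for x
    using Ck_on_Suc_has_derivative[OF Suc.prems(2) that] assms(1) that Suc.prems(1)
    by (rule has_derivative_transform_within_open)
  have eq: "frechet_derivative f (at x) = frechet_derivative g (at x)" if "x \<in> S" for x
    by (rule frechet_derivative_at[OF deriv[OF that]])
  have "Ck_on k (\<lambda>x. frechet_derivative g (at x) e) S" if "e \<in> Basis" for e
    using Suc.IH[of "\<lambda>x. frechet_derivative f (at x) e"] Suc.prems that eq by simp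
  then show ?case
    using deriv by (auto simp: differentiable_def)
qed

text \<open>Any family of derivatives may be exhibited, so that the choice hidden in \<^const>\<open>frechet_derivative\<close>
  need not be computed; openness of the domain lets the two be exchanged.\<close>

lemma Ck_on_SucI:
  assumes "open S" "\<And>x. x \<in> S \<Longrightarrow> (f has_derivative f' x) (at x)"
    and "\<And>e. e \<in> Basis \<Longrightarrow> Ck_on k (\<lambda>x. f' x e) S"
  shows "Ck_on (Suc k) f S"
proof -
  have "frechet_derivative f (at x) = f' x" if "x \<in> S" for x
    by (rule frechet_derivative_at[OF assms(2)[OF that], symmetric])
  then have "Ck_on k (\<lambda>x. frechet_derivative f (at x) e) S" if "e \<in> Basis" for e
    by (intro Ck_on_cong[OF assms(1) _ assms(3)[OF that]]) simp
  then show ?thesis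
    using assms(2) by (auto simp: differentiable_def)
qed

lemma Ck_on_SucD: "Ck_on (Suc k) f S \<Longrightarrow> Ck_on k f S"
proof (induction k arbitrary: f)
  case 0
  then show ?case
    by (auto intro!: continuous_at_imp_continuous_on differentiable_imp_continuous_within)
next
  case (Suc k)
  then show ?case
    by (auto simp del: Ck_on.simps(1))
qed

lemma Ck_on_const: "open S \<Longrightarrow> Ck_on k (\<lambda>x. c) S"
proof (induction k arbitrary: c)
  case (Suc k)
  show ?case
    by (rule Ck_on_SucI[OF Suc.prems has_derivative_const]) (rule Suc.IH[OF Suc.prems])
qed simp

lemma Ck_on_bounded_linear:
  assumes "bounded_linear L" "open S"
  shows "Ck_on k f S \<Longrightarrow> Ck_on k (\<lambda>x. L (f x)) S"
proof (induction k arbitrary: f)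
  case 0
  then show ?case by (simp add: bounded_linear.continuous_on[OF assms(1)])
next
  case (Suc k)
  show ?case
  proof (rule Ck_on_SucI[OF assms(2)])
    show "((\<lambda>x. L (f x)) has_derivative (\<lambda>h. L (frechet_derivative f (at x) h))) (at x)"
      if "x \<in> S" for x
      by (rule bounded_linear.has_derivative[OF assms(1) Ck_on_Suc_has_derivative[OF Suc.prems that]])
  qed (use Suc in auto)
qed

lemma Ck_on_add:
  assumes "open S"
  shows "Ck_on k f S \<Longrightarrow> Ck_on k g S \<Longrightarrow> Ck_on k (\<lambda>x. f x + g x) S"
proof (induction k arbitrary: f g)
  case 0
  then show ?case by (simp add: continuous_on_add)
next
  case (Suc k)
  show ?case
  proof (rule Ck_on_SucI[OF assms])
    show "((\<lambda>x. f x + g x) has_derivative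
        (\<lambda>h. frechet_derivative f (at x) h + frechet_derivative g (at x) h)) (at x)"
      if "x \<in> S" for x
      using Suc.prems that by (intro has_derivative_add Ck_on_Suc_has_derivative)
  qed (use Suc in auto)
qed

lemma Ck_on_sum:
  assumes "open S" "\<And>i. i \<in> A \<Longrightarrow> Ck_on k (f i) S"
  shows "Ck_on k (\<lambda>x. \<Sum>i\<in>A. f i x) S"
  using assms(2)
  by (induction A rule: infinite_finite_induct) (simp_all add: Ck_on_const Ck_on_add assms(1))

lemma Ck_on_scaleR:
  assumes "open S"
  shows "Ck_on k a S \<Longrightarrow> Ck_on k f S \<Longrightarrow> Ck_on k (\<lambda>x. a x *\<^sub>R f x) S"
proof (induction k arbitrary: a f)
  case 0
  then show ?case by (simp add: continuous_on_scaleR)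
next
  case (Suc k)
  show ?case
  proof (rule Ck_on_SucI[OF assms])
    show "((\<lambda>x. a x *\<^sub>R f x) has_derivative
        (\<lambda>h. a x *\<^sub>R frechet_derivative f (at x) h + frechet_derivative a (at x) h *\<^sub>R f x)) (at x)"
      if "x \<in> S" for x
      using Suc.prems that by (intro has_derivative_scaleR Ck_on_Suc_has_derivative)
  next
    fix e :: 'a assume e: "e \<in> Basis"
    show "Ck_on k (\<lambda>x. a x *\<^sub>R frechet_derivative f (at x) e
        + frechet_derivative a (at x) e *\<^sub>R f x) S"
      using Suc.prems[THEN Ck_on_SucD] Suc.prems e by (intro Ck_on_add[OF assms] Suc.IH) auto
  qed
qed

text \<open>The partial derivatives of \<open>f \<circ> g\<close> are sums of products of partial derivatives of \<open>g\<close> with partial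
  derivatives of \<open>f\<close> composed with \<open>g\<close>, so the induction needs nothing but closure under products and
  sums.\<close>

lemma Ck_on_compose:
  assumes "open S" "open T"
  shows "Ck_on k g S \<Longrightarrow> (\<And>x. x \<in> S \<Longrightarrow> g x \<in> T) \<Longrightarrow> Ck_on k f T \<Longrightarrow> Ck_on k (\<lambda>x. f (g x)) S"
proof (induction k arbitrary: f)
  case 0
  then show ?case by (auto intro!: continuous_on_compose2[of T f S g])
next
  case (Suc k)
  let ?Df = "\<lambda>c x. frechet_derivative f (at (g x)) c"
  let ?Dg = "\<lambda>e x. frechet_derivative g (at x) e"
  show ?case
  proof (rule Ck_on_SucI[OF assms(1)])
    show "((\<lambda>x. f (g x)) has_derivative (\<lambda>h. \<Sum>c\<in>Basis. inner (?Dg h x) c *\<^sub>R ?Df c x)) (at x)"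
      if x: "x \<in> S" for x
    proof -
      have f: "(f has_derivative frechet_derivative f (at (g x))) (at (g x))"
        using Suc.prems x by (intro Ck_on_Suc_has_derivative[of k f T]) auto
      have g: "(g has_derivative frechet_derivative g (at x)) (at x)"
        using Suc.prems x by (intro Ck_on_Suc_has_derivative[of k g S]) auto
      interpret bounded_linear "frechet_derivative f (at (g x))"
        using f by (rule has_derivative_bounded_linear)
      have expand: "frechet_derivative f (at (g x)) w = (\<Sum>c\<in>Basis. inner w c *\<^sub>R ?Df c x)" for w
        by (subst euclidean_representation[of w, symmetric]) (simp only: sum scaleR)
      show ?thesis
        by (rule has_derivative_eq_rhs[OF has_derivative_compose[OF g f]]) (rule ext, rule expand)
    qed
  next
    fix e :: 'a assume e: "e \<in> Basis"
    have "Ck_on k (\<lambda>x. ?Df c x) S" if "c \<in> Basis" for c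
      using Suc.prems that by (intro Suc.IH Ck_on_SucD[of k g]) auto
    moreover have "Ck_on k (\<lambda>x. inner (?Dg e x) c) S" for c
      using Suc.prems e by (intro Ck_on_bounded_linear[OF bounded_linear_inner_left assms(1)]) auto
    ultimately show "Ck_on k (\<lambda>x. \<Sum>c\<in>Basis. inner (?Dg e x) c *\<^sub>R ?Df c x) S"
      by (intro Ck_on_sum Ck_on_scaleR assms(1))
  qed
qed

lemma Ck_on_grad:
  assumes "open S" "Ck_on (Suc k) f S"
  shows "Ck_on k (grad f) S"
  unfolding grad_def[abs_def]
  using assms by (intro Ck_on_sum Ck_on_scaleR Ck_on_const) auto

lemma Ck_on_divergence:
  assumes "open S" "Ck_on (Suc k) f S"
  shows "Ck_on k (divergence f) S"
  unfolding divergence_def[abs_def]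
  using assms by (intro Ck_on_sum Ck_on_bounded_linear[OF bounded_linear_inner_left]) auto

lemma Ck_on_Pair:
  assumes "open S" "Ck_on k f S" "Ck_on k g S"
  shows "Ck_on k (\<lambda>x. (f x, g x)) S"
proof -
  have "Ck_on k (\<lambda>x. (f x, 0) + (0, g x)) S"
    using assms
      Ck_on_bounded_linear[OF bounded_linear_Pair[OF bounded_linear_ident bounded_linear_zero], of S k f]
      Ck_on_bounded_linear[OF bounded_linear_Pair[OF bounded_linear_zero bounded_linear_ident], of S k g]
    by (intro Ck_on_add)
  then show ?thesis by simp
qed

text \<open>The two partial derivatives of \<open>f\<close> in the variational derivative are separate derivatives in the
  first and in the second argument. Both are directional derivatives of the uncurried \<open>f\<close> along basis
  vectors, evaluated on the jet \<open>(r, \<nabla>r)\<close>. One order of smoothness is spent on the jet and these partial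
  derivatives, and one on the divergence.\<close>

lemma Ck_on_var_deriv:
  fixes f :: "real \<Rightarrow> 'a::euclidean_space \<Rightarrow> real"
  assumes f: "Ck_on (Suc (Suc k)) (\<lambda>(s, q). f s q) ({0<..} \<times> UNIV)"
    and r: "Ck_on (Suc (Suc k)) r UNIV" and pos: "\<And>x. r x > 0"
  shows "Ck_on k (var_deriv f r) UNIV"
proof -
  let ?U = "{0 :: real<..} \<times> (UNIV :: 'a set)"
  let ?f = "\<lambda>(s, q). f s q"
  let ?jet = "\<lambda>x. (r x, grad r x)"
  have U: "open ?U" by (intro open_Times open_greaterThan open_UNIV)
  have jet: "Ck_on (Suc k) ?jet UNIV"
    using r by (intro Ck_on_Pair Ck_on_grad Ck_on_SucD[of "Suc k" r]) auto
  have partial: "Ck_on (Suc k) (\<lambda>x. frechet_derivative ?f (at (?jet x)) e) UNIV" if "e \<in> Basis" for e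
    using f that pos by (intro Ck_on_compose[OF open_UNIV U jet]) auto
  have total: "(?f has_derivative frechet_derivative ?f (at (?jet x))) (at (?jet x))" for x
    using pos by (intro Ck_on_Suc_has_derivative[OF f]) auto
  have ds: "deriv (\<lambda>s. f s (grad r x)) (r x) = frechet_derivative ?f (at (?jet x)) (1, 0)" for x
  proof -
    interpret bounded_linear "frechet_derivative ?f (at (?jet x))"
      using total by (rule has_derivative_bounded_linear)
    have "((\<lambda>s. (s, grad r x)) has_derivative (\<lambda>h. (h, 0))) (at (r x))"
      by (auto intro!: derivative_eq_intros)
    from has_derivative_compose[OF this total]
    have chain: "((\<lambda>s. f s (grad r x)) has_derivative (\<lambda>h. frechet_derivative ?f (at (?jet x)) (h, 0))) (at (r x))"
      by simp
    have lin: "frechet_derivative ?f (at (?jet x)) (h, 0)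
        = frechet_derivative ?f (at (?jet x)) (1, 0) * h" for h
      using scaleR[of h "(1, 0)"] by (simp add: mult.commute)
    show ?thesis
      by (intro DERIV_imp_deriv, unfold has_field_derivative_def)
         (rule has_derivative_eq_rhs[OF chain], rule ext, rule lin)
  qed
  have dq: "grad (f (r x)) (grad r x)
      = (\<Sum>e\<in>Basis. frechet_derivative ?f (at (?jet x)) (0, e) *\<^sub>R e)" for x
  proof -
    have "((\<lambda>q. (r x, q)) has_derivative (\<lambda>h. (0, h))) (at (grad r x))"
      by (auto intro!: derivative_eq_intros)
    from has_derivative_compose[OF this total]
    have "(f (r x) has_derivative (\<lambda>h. frechet_derivative ?f (at (?jet x)) (0, h))) (at (grad r x))"
      by simp
    from frechet_derivative_at[OF this, symmetric] show ?thesis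
      by (simp add: grad_def)
  qed
  have "Ck_on (Suc k) (\<lambda>x. grad (f (r x)) (grad r x)) UNIV"
    unfolding dq
    by (intro Ck_on_sum Ck_on_scaleR partial Ck_on_const) (simp_all add: Basis_prod_def)
  then have "Ck_on k (\<lambda>x. - divergence (\<lambda>y. grad (f (r y)) (grad r y)) x) UNIV"
    by (intro Ck_on_bounded_linear[OF bounded_linear_minus] Ck_on_divergence bounded_linear_ident) auto
  moreover have "Ck_on k (\<lambda>x. deriv (\<lambda>s. f s (grad r x)) (r x)) UNIV"
    unfolding ds by (rule Ck_on_SucD, rule partial) (simp add: Basis_prod_def)
  ultimately have "Ck_on k (\<lambda>x. deriv (\<lambda>s. f s (grad r x)) (r x)
      + - divergence (\<lambda>y. grad (f (r y)) (grad r y)) x) UNIV"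
    by (intro Ck_on_add) auto
  then show ?thesis
    by (simp add: var_deriv_def[abs_def])
qed

section \<open>Solution of the friction system\<close>

text \<open>Real matrices have to act on tuples of spatial vectors: the unknowns of the friction system are
  velocities, while the coefficients are scalars.\<close>

definition mat_act :: "real mat \<Rightarrow> (nat \<Rightarrow> 'a::real_vector) \<Rightarrow> nat \<Rightarrow> 'a" where
  "mat_act A g i = (\<Sum>j<dim_col A. A $$ (i, j) *\<^sub>R g j)"

lemma mat_act_mult:
  assumes "A \<in> carrier_mat p q" "B \<in> carrier_mat q r" "i < p"
  shows "mat_act (A * B) g i = mat_act A (mat_act B g) i"
proof -
  have "mat_act (A * B) g i = (\<Sum>j<r. \<Sum>k<q. (A $$ (i, k) * B $$ (k, j)) *\<^sub>R g j)"
    using assms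
    by (auto simp: mat_act_def scalar_prod_def scaleR_sum_left lessThan_atLeast0 intro!: sum.cong)
  also have "\<dots> = mat_act A (mat_act B g) i"
    using assms by (subst sum.swap) (simp add: mat_act_def scaleR_sum_right)
  finally show ?thesis .
qed

lemma mat_act_one: "i < n \<Longrightarrow> mat_act (1\<^sub>m n) g i = g i"
  by (simp add: mat_act_def if_distrib[of "\<lambda>c. c *\<^sub>R _"] sum.delta cong: if_cong)

lemma mat_act_cong:
  assumes "\<And>j. j < dim_col A \<Longrightarrow> g j = h j"
  shows "mat_act A g i = mat_act A h i"
  using assms by (simp add: mat_act_def)

lemma mat_act_scaleR: "mat_act A (\<lambda>j. c *\<^sub>R g j) = (\<lambda>i. c *\<^sub>R mat_act A g i)"
  by (simp add: fun_eq_iff mat_act_def scaleR_sum_right mult.commute)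

lemma inverse_mat_act_iff:
  assumes "A \<in> carrier_mat m m" "B \<in> carrier_mat m m" "A * B = 1\<^sub>m m" "B * A = 1\<^sub>m m"
  shows "(\<forall>i<m. mat_act A w i = d i) \<longleftrightarrow> (\<forall>i<m. w i = mat_act B d i)"
proof (intro iffI allI impI)
  fix i assume w: "\<forall>i<m. mat_act A w i = d i" and i: "i < m"
  have "w i = mat_act B (mat_act A w) i"
    using assms i by (simp add: mat_act_mult[symmetric] mat_act_one)
  also have "\<dots> = mat_act B d i"
    using w assms by (intro mat_act_cong) auto
  finally show "w i = mat_act B d i" .
next
  fix i assume w: "\<forall>i<m. w i = mat_act B d i" and i: "i < m"
  have "mat_act A w i = mat_act A (mat_act B d) i"
    using w assms by (intro mat_act_cong) auto
  also have "\<dots> = d i"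
    using assms i by (simp add: mat_act_mult[symmetric] mat_act_one)
  finally show "mat_act A w i = d i" .
qed

lemma the_mat_inverse:
  fixes A :: "real mat"
  assumes A: "A \<in> carrier_mat n n" and det: "Determinant.det A \<noteq> 0"
  shows "the (mat_inverse A) \<in> carrier_mat n n"
    and "A * the (mat_inverse A) = 1\<^sub>m n" and "the (mat_inverse A) * A = 1\<^sub>m n"
proof -
  from mat_inverse(1)[OF A, of "()"] det_non_zero_imp_unit[OF A det, of "()"]
  obtain B where B: "mat_inverse A = Some B"
    by (cases "mat_inverse A") auto
  from mat_inverse(2)[OF A B] B
  show "the (mat_inverse A) \<in> carrier_mat n n"
    and "A * the (mat_inverse A) = 1\<^sub>m n" and "the (mat_inverse A) * A = 1\<^sub>m n"
    by auto
qed

text \<open>Each driving force is the force \<open>r\<^sub>i g\<^sub>i\<close> minus its share, by mass fraction, of the total force.\<close>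

lemma sum_driving_force:
  assumes "(\<Sum>k<n. r k) \<noteq> 0"
  shows "(\<Sum>i<n. driving_force n r g i) = 0"
proof -
  have "(\<Sum>i<n. driving_force n r g i)
      = - ((\<Sum>i<n. r i / (\<Sum>k<n. r k)) *\<^sub>R (\<Sum>j<n. r j *\<^sub>R g j)) + (\<Sum>i<n. r i *\<^sub>R g i)"
    unfolding driving_force_def by (simp only: sum.distrib sum_negf scaleR_sum_left)
  also have "(\<Sum>i<n. r i / (\<Sum>k<n. r k)) = 1"
    using assms by (simp add: sum_divide_distrib[symmetric])
  finally show ?thesis by simp
qed

text \<open>The densities at one point in space-time, with \<open>m\<close> the index of the last species.\<close>

locale mixture =
  fixes n m :: nat and b :: "real mat" and r :: "nat \<Rightarrow> real"
  assumes n_eq: "n = Suc m"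
    and cond_N: "condition_N n b"
    and pos: "\<And>i. i < n \<Longrightarrow> r i > 0"
begin

abbreviation mass :: real where "mass \<equiv> \<Sum>k<n. r k"

abbreviation tau_inv :: "real mat" where "tau_inv \<equiv> the (mat_inverse (tau_mat n b r))"

lemma mass_pos: "mass > 0"
  using pos n_eq by (intro sum_pos) auto

lemma b_sym:
  assumes "i < n" "j < n"
  shows "b $$ (i, j) = b $$ (j, i)"
proof -
  have b: "b \<in> carrier_mat n n" and sym: "transpose_mat b = b"
    using cond_N unfolding condition_N_def by blast+
  have "b $$ (i, j) = transpose_mat b $$ (i, j)"
    by (simp only: sym)
  also have "\<dots> = b $$ (j, i)"
    using b assms by simp
  finally show ?thesis .
qed

text \<open>The full matrix is the weighted graph Laplacian with weights \<open>b\<^sub>i\<^sub>j r\<^sub>i r\<^sub>j\<close>; the diagonal entries of \<open>b\<close>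
  cancel on both sides.\<close>

lemma friction_eq_tau_full:
  assumes "i < n"
  shows "(\<Sum>j<n. (b $$ (i, j) * r i * r j) *\<^sub>R (u i - u j)) = mat_act (tau_full n b r) u i"
proof -
  have "(if i = j then c else 0) *\<^sub>R u j = (if i = j then c *\<^sub>R u j else 0)" for c j
    by simp
  then show ?thesis
    using assms
    by (simp add: mat_act_def tau_full_def scaleR_diff_left scaleR_diff_right sum_subtractf
        scaleR_sum_left)
qed

lemma tau_full_shift:
  assumes "i < n"
  shows "mat_act (tau_full n b r) (\<lambda>j. u j - c) i = mat_act (tau_full n b r) u i"
  using friction_eq_tau_full[OF assms, of "\<lambda>j. u j - c"] friction_eq_tau_full[OF assms, of u]
  by simp

lemma tau_full_eq_tau_mat:
  assumes "i < m"
  shows "mat_act (tau_full n b r) u i = mat_act (tau_mat n b r) (\<lambda>j. u j - u m) i"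
proof -
  have "mat_act (tau_full n b r) u i = mat_act (tau_full n b r) (\<lambda>j. u j - u m) i"
    by (rule tau_full_shift[symmetric]) (use assms n_eq in simp)
  also have "\<dots> = mat_act (tau_mat n b r) (\<lambda>j. u j - u m) i"
    using assms n_eq by (simp add: mat_act_def tau_full_def tau_mat_def)
  finally show ?thesis .
qed

text \<open>By symmetry of \<open>b\<close> the column sums are row sums, and these are the friction of a constant velocity,
  which vanishes. Physically: friction conserves the total momentum.\<close>

lemma sum_tau_full: "(\<Sum>i<n. mat_act (tau_full n b r) u i) = 0"
proof -
  have "(\<Sum>i<n. mat_act (tau_full n b r) u i)
      = (\<Sum>j<n. (\<Sum>i<n. tau_full n b r $$ (i, j)) *\<^sub>R u j)"
    by (simp add: mat_act_def scaleR_sum_left tau_full_def) (rule sum.swap)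
  also have "\<dots> = (\<Sum>j<n. 0 *\<^sub>R u j)"
  proof (rule sum.cong[OF refl])
    fix j assume "j \<in> {..<n}"
    then have j: "j < n" by simp
    have "(\<Sum>i<n. tau_full n b r $$ (i, j)) = mat_act (tau_full n b r) (\<lambda>_. 1::real) j"
      using j by (auto simp: mat_act_def tau_full_def b_sym mult_ac intro!: sum.cong)
    also have "\<dots> = 0"
      using friction_eq_tau_full[OF j, of "\<lambda>_. 1::real"] by simp
    finally show "(\<Sum>i<n. tau_full n b r $$ (i, j)) *\<^sub>R u j = 0 *\<^sub>R u j" by simp
  qed
  finally show ?thesis by simp
qed

lemma tau_mat_carrier: "tau_mat n b r \<in> carrier_mat m m"
  by (simp add: tau_mat_def n_eq)

text \<open>A kernel vector of the reduced matrix, extended by zero, is annihilated by the first \<open>m\<close> rows of the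
  full matrix and therefore by the last one too. Condition (N) makes it constant, and its last entry is
  zero.\<close>

lemma det_tau_mat: "Determinant.det (tau_mat n b r) \<noteq> 0"
proof
  assume "Determinant.det (tau_mat n b r) = 0"
  then obtain w where w: "w \<in> carrier_vec m" "w \<noteq> 0\<^sub>v m" "tau_mat n b r *\<^sub>v w = 0\<^sub>v m"
    using det_0_iff_vec_prod_zero_field[OF tau_mat_carrier] by blast
  define W where "W = Matrix.vec n (\<lambda>i. if i < m then vec_index w i else 0)"
  let ?L = "mat_act (tau_full n b r) (vec_index W)"
  have low: "?L i = 0" if i: "i < m" for i
  proof -
    have "?L i = mat_act (tau_mat n b r) (\<lambda>j. vec_index W j - vec_index W m) i"
      by (rule tau_full_eq_tau_mat[OF i])
    also have "\<dots> = vec_index (tau_mat n b r *\<^sub>v w) i"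
      using w(1) i tau_mat_carrier n_eq
      by (auto simp: mat_act_def W_def scalar_prod_def lessThan_atLeast0 intro!: sum.cong)
    finally show ?thesis using w(3) i by simp
  qed
  moreover have "?L m = 0"
    using sum_tau_full[of "vec_index W"] low by (simp add: n_eq)
  ultimately have "?L i = 0" if "i < n" for i
    using that n_eq by (cases "i = m") auto
  then have "W \<in> {w \<in> carrier_vec n.
       \<forall>i<n. (\<Sum>j<n. b $$ (i, j) * r i * r j * (vec_index w i - vec_index w j)) = 0}"
    using friction_eq_tau_full[of _ "vec_index W"] by (auto simp: W_def)
  then obtain c where c: "W = c \<cdot>\<^sub>v Matrix.vec n (\<lambda>_. 1)"
    using cond_N pos unfolding condition_N_def by blast
  have "vec_index W m = 0" by (simp add: W_def n_eq)
  with c have "c = 0" by (simp add: n_eq)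
  have "vec_index w i = 0" if "i < m" for i
  proof -
    have "vec_index w i = vec_index W i" using that by (simp add: W_def n_eq)
    also have "\<dots> = 0" using c \<open>c = 0\<close> that by (simp add: n_eq)
    finally show ?thesis .
  qed
  with w(1) have "w = 0\<^sub>v m" by (intro eq_vecI) auto
  with w(2) show False by simp
qed

lemmas tau_inv_carrier = the_mat_inverse(1)[OF tau_mat_carrier det_tau_mat]
lemmas tau_inv_right = the_mat_inverse(2)[OF tau_mat_carrier det_tau_mat]
lemmas tau_inv_left = the_mat_inverse(3)[OF tau_mat_carrier det_tau_mat]

lemma invertible_tau_mat: "invertible_mat (tau_mat n b r)"
  using tau_mat_carrier tau_inv_carrier tau_inv_left tau_inv_right
  unfolding invertible_mat_def inverts_mat_def by (auto intro!: exI[of _ tau_inv])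

text \<open>Both sides of the balance equations sum to zero over all species, so the last equation is redundant;
  the others only see velocities relative to the last species.\<close>

lemma balance_iff_reduced:
  fixes u g :: "nat \<Rightarrow> 'a::real_vector"
  shows "(\<forall>i<n. - (\<Sum>j<n. (b $$ (i, j) * r i * r j) *\<^sub>R (u i - u j)) = \<epsilon> *\<^sub>R driving_force n r g i)
   \<longleftrightarrow> (\<forall>i<m. u i - u m = - \<epsilon> *\<^sub>R mat_act tau_inv (driving_force n r g) i)"
    (is "?all \<longleftrightarrow> ?rel")
proof -
  let ?L = "mat_act (tau_full n b r) u" and ?d = "\<lambda>i. - \<epsilon> *\<^sub>R driving_force n r g i"
  have "- x = \<epsilon> *\<^sub>R y \<longleftrightarrow> x = - \<epsilon> *\<^sub>R y" for x y :: 'a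
    by (metis minus_minus scaleR_minus_left)
  then have "?all \<longleftrightarrow> (\<forall>i<n. ?L i = ?d i)"
    by (simp only: friction_eq_tau_full cong: imp_cong)
  also have "\<dots> \<longleftrightarrow> (\<forall>i<m. ?L i = ?d i)"
  proof -
    have "?L m = ?d m" if low: "\<forall>i<m. ?L i = ?d i"
    proof -
      have "(\<Sum>i<n. ?d i) = 0"
        using sum_driving_force[of r n g] mass_pos by (simp add: scaleR_sum_right[symmetric] sum_negf)
      then have "(\<Sum>i<n. ?L i) = (\<Sum>i<n. ?d i)"
        using sum_tau_full[of u] by simp
      with low show ?thesis by (simp add: n_eq)
    qed
    then show ?thesis by (auto simp: n_eq less_Suc_eq)
  qed
  also have "\<dots> \<longleftrightarrow> (\<forall>i<m. mat_act (tau_mat n b r) (\<lambda>j. u j - u m) i = ?d i)"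
    by (simp add: tau_full_eq_tau_mat)
  also have "\<dots> \<longleftrightarrow> (\<forall>i<m. u i - u m = mat_act tau_inv ?d i)"
    by (rule inverse_mat_act_iff[OF tau_mat_carrier tau_inv_carrier tau_inv_right tau_inv_left])
  finally show ?thesis by (simp only: mat_act_scaleR)
qed

text \<open>Vanishing total momentum determines the velocity of the last species as minus the mass average of the
  velocities relative to it.\<close>

lemma velocity_from_differences:
  fixes u w :: "nat \<Rightarrow> 'a::real_vector"
  shows "(\<forall>i<m. u i - u m = w i) \<and> (\<Sum>j<n. r j *\<^sub>R u j) = 0
    \<longleftrightarrow> (\<forall>i<n. u i = (if i < m then w i else 0) - (1 / mass) *\<^sub>R (\<Sum>k<m. r k *\<^sub>R w k))"
    (is "?diff \<and> ?zero \<longleftrightarrow> ?expl")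
proof -
  let ?S = "\<Sum>k<m. r k *\<^sub>R w k"
  have momentum: "(\<Sum>j<n. r j *\<^sub>R u j) = ?S + mass *\<^sub>R u m" if "\<forall>i<m. u i = w i + u m"
    using that by (simp add: n_eq scaleR_add_right sum.distrib scaleR_add_left scaleR_sum_left)
  have mean: "?S + mass *\<^sub>R c = 0 \<longleftrightarrow> c = - ((1 / mass) *\<^sub>R ?S)" for c
  proof
    assume "?S + mass *\<^sub>R c = 0"
    then have "mass *\<^sub>R c = - ?S" by (simp add: eq_neg_iff_add_eq_0 add.commute)
    then have "(1 / mass) *\<^sub>R (mass *\<^sub>R c) = (1 / mass) *\<^sub>R (- ?S)" by simp
    then show "c = - ((1 / mass) *\<^sub>R ?S)" using mass_pos by simp
  qed (use mass_pos in simp)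
  define c where "c = (1 / mass) *\<^sub>R ?S"
  have "?diff \<longleftrightarrow> (\<forall>i<m. u i = w i + u m)" by (auto simp: diff_eq_eq)
  moreover have "?zero \<longleftrightarrow> u m = - c" if "\<forall>i<m. u i = w i + u m"
    unfolding momentum[OF that] c_def by (rule mean)
  ultimately have "?diff \<and> ?zero \<longleftrightarrow> (\<forall>i<m. u i = w i + u m) \<and> u m = - c"
    by blast
  also have "\<dots> \<longleftrightarrow> (\<forall>i<n. u i = (if i < m then w i else 0) - c)"
    by (auto simp: n_eq less_Suc_eq)
  finally show ?thesis unfolding c_def .
qed

lemma Qinv_act:
  assumes "i < m"
  shows "mat_act (Qinv_mat n r) w i = r i *\<^sub>R w i - (r i / mass) *\<^sub>R (\<Sum>k<m. r k *\<^sub>R w k)"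
proof -
  have "(if i = j then c else 0) *\<^sub>R w j = (if i = j then c *\<^sub>R w j else 0)" for c j
    by simp
  then show ?thesis
    using assms
    by (simp add: mat_act_def Qinv_mat_def n_eq scaleR_diff_left sum_subtractf scaleR_sum_right)
qed

lemma G_act:
  assumes "i < n"
  shows "mat_act (G_mat n) w i = (if i < m then w i else - (\<Sum>k<m. w k))"
proof (cases "i < m")
  case True
  have "(if i = j then 1 else 0) *\<^sub>R w j = (if i = j then w j else 0)" for j
    by simp
  then show ?thesis using True by (simp add: mat_act_def G_mat_def n_eq)
next
  case False
  then have "i = m" using assms n_eq by simp
  then show ?thesis by (simp add: mat_act_def G_mat_def n_eq sum_negf[symmetric])
qed

lemma G_transpose_act:
  assumes "k < m"
  shows "mat_act (transpose_mat (G_mat n)) g k = g k - g m"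
  using assms 
  by (simp add: mat_act_def G_mat_def n_eq if_distrib[of "\<lambda>c. c *\<^sub>R _"] cong: if_cong)

text \<open>Driving forces do not change when a common vector is subtracted from all gradients. For the
  vector \<open>g\<^sub>m\<close> the term of the last species vanishes, so that the sum over \<open>m\<close> species in \<open>Q\<^sup>-\<^sup>1\<close> is the
  sum over all of them.\<close>

lemma Qinv_G_transpose_act:
  assumes "i < m"
  shows "mat_act (Qinv_mat n r) (mat_act (transpose_mat (G_mat n)) g) i = driving_force n r g i"
proof -
  let ?S = "\<Sum>k<m. r k *\<^sub>R g k"
  have "mat_act (Qinv_mat n r) (mat_act (transpose_mat (G_mat n)) g) i
      = mat_act (Qinv_mat n r) (\<lambda>k. g k - g m) i"
    by (intro mat_act_cong G_transpose_act) (simp add: Qinv_mat_def n_eq)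
  also have "\<dots> = r i *\<^sub>R (g i - g m) - (r i / mass) *\<^sub>R (\<Sum>k<m. r k *\<^sub>R (g k - g m))"
    by (rule Qinv_act[OF assms])
  also have "(\<Sum>k<m. r k *\<^sub>R (g k - g m)) = (\<Sum>k<n. r k *\<^sub>R g k) - mass *\<^sub>R g m"
    by (simp add: n_eq scaleR_diff_right sum_subtractf scaleR_sum_left scaleR_add_left)
  finally show ?thesis
    using mass_pos by (simp add: driving_force_def scaleR_diff_right)
qed

lemma D_act:
  assumes "i < n"
  shows "mat_act (D_mat n b r) g i
    = mat_act (G_mat n) (mat_act (Qinv_mat n r) (mat_act tau_inv (driving_force n r g))) i"
proof -
  have G: "G_mat n \<in> carrier_mat n m" and GT: "transpose_mat (G_mat n) \<in> carrier_mat m n"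
    and Q: "Qinv_mat n r \<in> carrier_mat m m"
    by (simp_all add: G_mat_def Qinv_mat_def n_eq)
  note GQ = mult_carrier_mat[OF G Q]
  note GQT = mult_carrier_mat[OF GQ tau_inv_carrier]
  note GQTQ = mult_carrier_mat[OF GQT Q]
  have "mat_act (D_mat n b r) g i = mat_act (G_mat n * Qinv_mat n r * tau_inv)
      (mat_act (Qinv_mat n r) (mat_act (transpose_mat (G_mat n)) g)) i"
    unfolding D_mat_def
    by (simp only: mat_act_mult[OF GQTQ GT assms] mat_act_mult[OF GQT Q assms])
  also have "\<dots> = mat_act (G_mat n * Qinv_mat n r * tau_inv) (driving_force n r g) i"
    by (intro mat_act_cong Qinv_G_transpose_act) (use tau_inv_carrier in simp)
  also have "\<dots> = mat_act (G_mat n) (mat_act (Qinv_mat n r) (mat_act tau_inv (driving_force n r g))) i"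
    by (simp only: mat_act_mult[OF GQ tau_inv_carrier assms] mat_act_mult[OF G Q assms])
  finally show ?thesis .
qed

text \<open>The right-hand side is \<open>r\<^sub>i u\<^sub>i\<close> for the velocities of \<open>velocity_from_differences\<close>. For the last
  species the row of \<open>-1\<close> in \<open>G\<close> produces minus the sum of the other fluxes, as the momentum constraint
  demands.\<close>

lemma G_Qinv_act:
  assumes "i < n"
  shows "mat_act (G_mat n) (mat_act (Qinv_mat n r) w) i
    = r i *\<^sub>R ((if i < m then w i else 0) - (1 / mass) *\<^sub>R (\<Sum>k<m. r k *\<^sub>R w k))"
proof (cases "i < m")
  case True
  then show ?thesis
    using assms by (simp add: G_act Qinv_act scaleR_diff_right)
next
  case False
  let ?S = "\<Sum>k<m. r k *\<^sub>R w k"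
  have i: "i = m" using False assms n_eq by simp
  have "(\<Sum>k<m. mat_act (Qinv_mat n r) w k) = ?S - ((\<Sum>k<m. r k) / mass) *\<^sub>R ?S"
    by (simp add: Qinv_act sum_subtractf scaleR_sum_left[symmetric] sum_divide_distrib)
  also have "\<dots> = (1 - (\<Sum>k<m. r k) / mass) *\<^sub>R ?S"
    by (simp add: scaleR_diff_left)
  also have "1 - (\<Sum>k<m. r k) / mass = r m / mass"
    using mass_pos by (simp add: field_simps n_eq)
  finally show ?thesis
    using i assms by (simp add: G_act)
qed

text \<open>The identity of fluxes characterizes the solution, since positive densities can be cancelled;
  existence and uniqueness are then immediate.\<close>

lemma solves_rel_velocity_iff:
  fixes g u :: "nat \<Rightarrow> 'a::real_vector"
  shows "solves_rel_velocity n b \<epsilon> r g u \<longleftrightarrow>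
     u \<in> extensional {..<n} \<and> (\<forall>i<n. r i *\<^sub>R u i = - \<epsilon> *\<^sub>R mat_act (D_mat n b r) g i)"
proof -
  let ?w = "mat_act tau_inv (driving_force n r g)"
  have r_cancel: "r i *\<^sub>R x = r i *\<^sub>R y \<longleftrightarrow> x = y" if "i < n" for i and x y :: 'a
    using pos[OF that] by simp
  have "solves_rel_velocity n b \<epsilon> r g u \<longleftrightarrow> u \<in> extensional {..<n} \<and>
      (\<forall>i<m. u i - u m = - \<epsilon> *\<^sub>R ?w i) \<and> (\<Sum>j<n. r j *\<^sub>R u j) = 0"
    unfolding solves_rel_velocity_def balance_iff_reduced ..
  also have "\<dots> \<longleftrightarrow> u \<in> extensional {..<n} \<and>
      (\<forall>i<n. u i = (if i < m then - \<epsilon> *\<^sub>R ?w i else 0)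
        - (1 / mass) *\<^sub>R (\<Sum>k<m. r k *\<^sub>R - \<epsilon> *\<^sub>R ?w k))"
    by (subst velocity_from_differences) (rule refl)
  also have "\<dots> \<longleftrightarrow> u \<in> extensional {..<n} \<and>
      (\<forall>i<n. r i *\<^sub>R u i = mat_act (G_mat n) (mat_act (Qinv_mat n r) (\<lambda>k. - \<epsilon> *\<^sub>R ?w k)) i)"
    by (simp only: G_Qinv_act r_cancel cong: imp_cong)
  also have "\<dots> \<longleftrightarrow> u \<in> extensional {..<n} \<and>
      (\<forall>i<n. r i *\<^sub>R u i = - \<epsilon> *\<^sub>R mat_act (D_mat n b r) g i)"
    by (simp only: D_act mat_act_scaleR cong: imp_cong)
  finally show ?thesis .
qed

lemma ex1_solves_rel_velocity: "\<exists>!u. solves_rel_velocity n b \<epsilon> r g u"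
proof
  let ?u = "\<lambda>i\<in>{..<n}. (1 / r i) *\<^sub>R (- \<epsilon> *\<^sub>R mat_act (D_mat n b r) g i)"
  show "solves_rel_velocity n b \<epsilon> r g ?u"
    unfolding solves_rel_velocity_iff using pos by (auto simp: less_imp_neq[symmetric])
  fix u assume "solves_rel_velocity n b \<epsilon> r g u"
  then have u: "u \<in> extensional {..<n}"
      "\<And>i. i < n \<Longrightarrow> r i *\<^sub>R u i = - \<epsilon> *\<^sub>R mat_act (D_mat n b r) g i"
    unfolding solves_rel_velocity_iff by auto
  show "u = ?u"
  proof (rule extensionalityI[OF u(1) restrict_extensional])
    fix i assume "i \<in> {..<n}"
    then have i: "i < n" by simp
    have "u i = (1 / r i) *\<^sub>R (r i *\<^sub>R u i)"
      using pos[OF i] by simp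
    then show "u i = ?u i"
      using i by (simp only: u(2)) simp
  qed
qed

lemma density_rel_velocity:
  assumes "i < n"
  shows "r i *\<^sub>R rel_velocity n b \<epsilon> r g i = - \<epsilon> *\<^sub>R mat_act (D_mat n b r) g i"
proof -
  have "solves_rel_velocity n b \<epsilon> r g (rel_velocity n b \<epsilon> r g)"
    unfolding rel_velocity_def by (rule theI'[OF ex1_solves_rel_velocity])
  then have "\<forall>i<n. r i *\<^sub>R rel_velocity n b \<epsilon> r g i = - \<epsilon> *\<^sub>R mat_act (D_mat n b r) g i"
    by (rule solves_rel_velocity_iff[THEN iffD1, THEN conjunct2])
  with assms show ?thesis by (elim allE impE)
qed

end

section \<open>Differentiability of the diffusion matrix\<close>

lemma differentiable_prod:
  fixes f :: "'i \<Rightarrow> 'a::real_normed_vector \<Rightarrow> 'b::real_normed_field"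
  assumes "\<And>i. i \<in> A \<Longrightarrow> f i differentiable (at x within S)"
  shows "(\<lambda>x. \<Prod>i\<in>A. f i x) differentiable (at x within S)"
  using assms
  by (induction A rule: infinite_finite_induct) simp_all

text \<open>Matrices of all sizes share one type, which is no normed space, so differentiability of a
  matrix-valued map is stated entry by entry.\<close>

definition entries_differentiable :: "('a::real_normed_vector \<Rightarrow> real mat) \<Rightarrow> nat \<Rightarrow> nat \<Rightarrow> 'a \<Rightarrow> bool"
  where
  "entries_differentiable A p q x \<longleftrightarrow> (\<forall>y. A y \<in> carrier_mat p q) \<and>
     (\<forall>i<p. \<forall>j<q. (\<lambda>y. A y $$ (i, j)) differentiable (at x))"

lemma entries_differentiable_mult:
  assumes "entries_differentiable A p q x" "entries_differentiable B q s x"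
  shows "entries_differentiable (\<lambda>y. A y * B y) p s x"
proof -
  have A: "A y \<in> carrier_mat p q" and B: "B y \<in> carrier_mat q s" for y
    using assms by (simp_all add: entries_differentiable_def)
  have "(\<lambda>y. (A y * B y) $$ (i, j)) differentiable (at x)" if ij: "i < p" "j < s" for i j
  proof -
    have "(A y * B y) $$ (i, j) = (\<Sum>k<q. A y $$ (i, k) * B y $$ (k, j))" for y
      using A[of y] B[of y] ij by (simp add: scalar_prod_def lessThan_atLeast0)
    moreover have "(\<lambda>y. \<Sum>k<q. A y $$ (i, k) * B y $$ (k, j)) differentiable (at x)"
      using assms ij
      by (intro differentiable_sum differentiable_mult) (simp_all add: entries_differentiable_def)
    ultimately show ?thesis by simp
  qed
  then show ?thesis
    using mult_carrier_mat[OF A B] by (simp add: entries_differentiable_def)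
qed

lemma entries_differentiable_const:
  "A \<in> carrier_mat p q \<Longrightarrow> entries_differentiable (\<lambda>_. A) p q x"
  by (simp add: entries_differentiable_def)

text \<open>The Leibniz formula is polynomial in the entries.\<close>

lemma differentiable_det:
  assumes "entries_differentiable A k k x"
  shows "(\<lambda>y. Determinant.det (A y)) differentiable (at x)"
proof -
  have "Determinant.det (A y)
      = (\<Sum>p\<in>{p. p permutes {0..<k}}. signof p * (\<Prod>i = 0..<k. A y $$ (i, p i)))" for y
    using assms by (intro det_def') (simp add: entries_differentiable_def)
  moreover have "(\<lambda>y. \<Sum>p\<in>{p. p permutes {0..<k}}. signof p * (\<Prod>i = 0..<k. A y $$ (i, p i)))
      differentiable (at x)"
  proof (intro differentiable_sum differentiable_mult differentiable_prod ballI)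
    fix p i assume "p \<in> {p. p permutes {0..<k}}" "i \<in> {0..<k}"
    then have "i < k" "p i < k"
      using permutes_in_image[of p "{0..<k}" i] by auto
    then show "(\<lambda>y. A y $$ (i, p i)) differentiable (at x)"
      using assms by (simp add: entries_differentiable_def)
  qed (simp_all add: finite_permutations)
  ultimately show ?thesis by simp
qed

lemma entries_differentiable_adj:
  assumes "entries_differentiable A k k x"
  shows "entries_differentiable (\<lambda>y. adj_mat (A y)) k k x"
proof -
  have A: "A y \<in> carrier_mat k k" for y
    using assms by (simp add: entries_differentiable_def)
  have "(\<lambda>y. adj_mat (A y) $$ (i, j)) differentiable (at x)" if ij: "i < k" "j < k" for i j
  proof -
    have "adj_mat (A y) $$ (i, j) = (- 1) ^ (j + i) * Determinant.det (mat_delete (A y) j i)" for y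
      using A[of y] ij by (simp add: adj_mat_def cofactor_def)
    moreover have "entries_differentiable (\<lambda>y. mat_delete (A y) j i) (k - 1) (k - 1) x"
    proof -
      have "mat_delete (A y) j i $$ (p, q)
          = A y $$ (if p < j then p else Suc p, if q < i then q else Suc q)"
        if "p < k - 1" "q < k - 1" for y p q
        using A[of y] that by (simp add: mat_delete_def)
      moreover have "mat_delete (A y) j i \<in> carrier_mat (k - 1) (k - 1)" for y
        using A[of y] by (rule mat_delete_carrier)
      ultimately show ?thesis
        using assms by (simp add: entries_differentiable_def)
    qed
    ultimately show ?thesis
      using differentiable_det by (simp add: differentiable_mult)
  qed
  then show ?thesis
    using adj_mat(1)[OF A] by (simp add: entries_differentiable_def)
qed

text \<open>Cramer's rule expresses the entries of the inverse as rational functions of those of \<open>A\<close> whose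
  denominator does not vanish.\<close>

lemma entries_differentiable_inverse:
  assumes A: "entries_differentiable A k k x"
    and B: "\<And>y. B y \<in> carrier_mat k k"
    and inv: "\<And>y. B y * A y = 1\<^sub>m k"
  shows "entries_differentiable B k k x"
proof -
  have Ac: "A y \<in> carrier_mat k k" for y
    using A by (simp add: entries_differentiable_def)
  have det: "Determinant.det (A y) \<noteq> 0" for y
    using det_mult[OF B[of y] Ac[of y]] by (auto simp: inv det_one)
  have cramer: "adj_mat (A y) = Determinant.det (A y) \<cdot>\<^sub>m B y" for y
  proof -
    note adj = adj_mat[OF Ac[of y]]
    have "adj_mat (A y) = (B y * A y) * adj_mat (A y)"
      unfolding inv using adj(1) by simp
    also have "\<dots> = B y * (A y * adj_mat (A y))"
      using B[of y] Ac[of y] adj(1) by (rule assoc_mult_mat)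
    also have "\<dots> = Determinant.det (A y) \<cdot>\<^sub>m B y"
      by (simp only: adj(2) mult_smult_distrib[OF B[of y] one_carrier_mat] right_mult_one_mat[OF B[of y]])
    finally show ?thesis .
  qed
  have "(\<lambda>y. B y $$ (i, j)) differentiable (at x)" if ij: "i < k" "j < k" for i j
  proof -
    have "B y $$ (i, j) = adj_mat (A y) $$ (i, j) / Determinant.det (A y)" for y
      using B[of y] ij det[of y] by (simp add: cramer)
    moreover have "(\<lambda>y. adj_mat (A y) $$ (i, j) / Determinant.det (A y)) differentiable (at x)"
      using entries_differentiable_adj[OF A] differentiable_det[OF A] det ij
      by (intro differentiable_divide) (simp_all add: entries_differentiable_def)
    ultimately show ?thesis by simp
  qed
  then show ?thesis
    using B by (simp add: entries_differentiable_def)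
qed

lemma entries_differentiable_D_mat:
  assumes cond_N: "condition_N n b" and n: "n \<ge> 1"
    and pos: "\<And>k y. k < n \<Longrightarrow> r y k > 0"
    and diff: "\<And>k. k < n \<Longrightarrow> (\<lambda>y. r y k) differentiable (at x)"
  shows "entries_differentiable (\<lambda>y. D_mat n b (r y)) n n x"
proof -
  obtain m where m: "n = Suc m" using n by (cases n) auto
  then have n1: "n - Suc 0 = m" by simp
  have mix: "mixture n m b (r y)" for y
    using m cond_N pos by (simp add: mixture_def)
  have mass_diff: "(\<lambda>y. \<Sum>k<n. r y k) differentiable (at x)"
    using diff by (intro differentiable_sum) auto
  have mass_nz: "(\<Sum>k<n. r y k) \<noteq> 0" for y
    using mixture.mass_pos[OF mix[of y]] by simp
  have G: "entries_differentiable (\<lambda>_. G_mat n) n m x"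
    by (rule entries_differentiable_const) (simp add: G_mat_def m)
  have GT: "entries_differentiable (\<lambda>_. transpose_mat (G_mat n)) m n x"
    by (rule entries_differentiable_const) (simp add: G_mat_def m)
  have Q: "entries_differentiable (\<lambda>y. Qinv_mat n (r y)) m m x"
    unfolding entries_differentiable_def
  proof (intro conjI allI impI)
    fix i j assume ij: "i < m" "j < m"
    have d: "(\<lambda>y. r y i) differentiable (at x)" "(\<lambda>y. r y j) differentiable (at x)"
      using diff ij m by simp_all
    have "(\<lambda>y. (if i = j then r y i else 0) - r y i * r y j / (\<Sum>k<n. r y k))
        differentiable (at x)"
      using d mass_diff mass_nz
      by (cases "i = j") (simp_all add: differentiable_diff differentiable_divide differentiable_mult)
    then show "(\<lambda>y. Qinv_mat n (r y) $$ (i, j)) differentiable (at x)"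
      using ij by (simp add: Qinv_mat_def n1)
  qed (simp add: Qinv_mat_def m)
  have tau: "entries_differentiable (\<lambda>y. tau_mat n b (r y)) m m x"
    unfolding entries_differentiable_def
  proof (intro conjI allI impI)
    fix i j assume ij: "i < m" "j < m"
    then have lt: "i < n" "j < n" using m by simp_all
    have "(\<lambda>y. (if i = j then \<Sum>k<n. b $$ (i, k) * r y i * r y k else 0) - b $$ (i, j) * r y i * r y j)
        differentiable (at x)"
      using diff lt
      by (cases "i = j")
         (auto intro!: differentiable_diff differentiable_sum differentiable_mult)
    then show "(\<lambda>y. tau_mat n b (r y) $$ (i, j)) differentiable (at x)"
      using ij lt by (simp add: tau_mat_def tau_full_def n1)
  qed (simp add: tau_mat_def m)
  have T: "entries_differentiable (\<lambda>y. the (mat_inverse (tau_mat n b (r y)))) m m x"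
    using tau mixture.tau_inv_carrier[OF mix] mixture.tau_inv_left[OF mix]
    by (rule entries_differentiable_inverse)
  show ?thesis
    unfolding D_mat_def by (intro entries_differentiable_mult[OF _ GT] entries_differentiable_mult[OF _ Q]
      entries_differentiable_mult[OF _ T] G)
qed

lemma Ck_on_Suc_differentiable: "Ck_on (Suc k) f UNIV \<Longrightarrow> f differentiable (at x)"
  by simp

lemma divergence_scaleR:
  assumes "f differentiable (at x)"
  shows "divergence (\<lambda>y. c *\<^sub>R f y) x = c * divergence f x"
proof -
  have "((\<lambda>y. c *\<^sub>R f y) has_derivative (\<lambda>h. c *\<^sub>R frechet_derivative f (at x) h)) (at x)"
    using assms by (intro has_derivative_scaleR_right) (rule frechet_derivative_works[THEN iffD1])
  from frechet_derivative_at[OF this, symmetric] show ?thesis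
    by (simp add: divergence_def sum_distrib_left)
qed

section \<open>Equivalence of the two systems\<close>

theorem lemma2:
  fixes n :: nat and b :: "real mat" and \<epsilon> :: real
    and F :: "nat \<Rightarrow> real \<Rightarrow> real ^ 3 \<Rightarrow> real"
    and I :: "real set"
    and \<rho> :: "nat \<Rightarrow> real \<Rightarrow> real ^ 3 \<Rightarrow> real"
    and v :: "real \<Rightarrow> real ^ 3 \<Rightarrow> real ^ 3"
  assumes "n \<ge> 1" and "\<epsilon> > 0" and "condition_N n b"
    and "open I"
    and "\<And>i. i < n \<Longrightarrow> Ck_on 4 (\<lambda>(r, q). F i r q) ({0<..} \<times> UNIV)"
    and "\<And>i t x. i < n \<Longrightarrow> t \<in> I \<Longrightarrow> \<rho> i t x > 0"
    and "\<And>i t. i < n \<Longrightarrow> t \<in> I \<Longrightarrow> Ck_on 4 (\<rho> i t) UNIV"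
    and "\<And>i x. i < n \<Longrightarrow> Ck_on 1 (\<lambda>t. \<rho> i t x) I"
    and "\<And>t. t \<in> I \<Longrightarrow> Ck_on 1 (v t) UNIV"
    and "\<And>x. Ck_on 1 (\<lambda>t. v t x) I"
  shows "(\<forall>t\<in>I. \<forall>x. \<exists>!u. solves_rel_velocity n b \<epsilon> (\<lambda>k. \<rho> k t x) (grad_var F \<rho> t x) u) \<and>
    (\<forall>t\<in>I. \<forall>x. invertible_mat (tau_mat n b (\<lambda>k. \<rho> k t x))) \<and>
    (relative_velocity_system n b \<epsilon> F I \<rho> v \<longleftrightarrow> diffusion_system n b \<epsilon> F I \<rho> v)"
proof -
  obtain m where m: "n = Suc m"
    using \<open>n \<ge> 1\<close> by (cases n) auto
  have mix: "mixture n m b (\<lambda>k. \<rho> k t x)" if "t \<in> I" for t x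
    using m \<open>condition_N n b\<close> assms(6)[OF _ that] by (simp add: mixture_def)
  have four: "(4::nat) = Suc (Suc (Suc (Suc 0)))" by simp
  (* The two fluxes agree at every point; differentiability lets the divergence absorb the factor. *)
  have flux_divergence: "- divergence
        (\<lambda>y. \<rho> i t y *\<^sub>R rel_velocity n b \<epsilon> (\<lambda>k. \<rho> k t y) (grad_var F \<rho> t y) i) x
      = \<epsilon> * divergence
        (\<lambda>y. \<Sum>j<n. D_mat n b (\<lambda>k. \<rho> k t y) $$ (i, j) *\<^sub>R grad_var F \<rho> t y j) x"
    if t: "t \<in> I" and i: "i < n" for t i x
  proof -
    let ?D = "\<lambda>y. D_mat n b (\<lambda>k. \<rho> k t y)"
    let ?flux = "\<lambda>y. \<Sum>j<n. ?D y $$ (i, j) *\<^sub>R grad_var F \<rho> t y j"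
    have \<rho>_diff: "\<rho> k t differentiable (at x)" if "k < n" for k
      using assms(7)[OF that t] unfolding four by (rule Ck_on_Suc_differentiable)
    have D: "entries_differentiable ?D n n x"
      using \<open>condition_N n b\<close> \<open>n \<ge> 1\<close> assms(6)[OF _ t] \<rho>_diff
      by (intro entries_differentiable_D_mat) auto
    have "(\<lambda>y. grad_var F \<rho> t y j) differentiable (at x)" if j: "j < n" for j
    proof -
      have "Ck_on (Suc (Suc 0)) (var_deriv (F j) (\<rho> j t)) UNIV"
        using assms(5)[OF j] assms(7)[OF j t] assms(6)[OF j t] unfolding four
        by (rule Ck_on_var_deriv)
      then have "Ck_on (Suc 0) (grad (var_deriv (F j) (\<rho> j t))) UNIV"
        by (rule Ck_on_grad[OF open_UNIV])
      then show ?thesis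
        unfolding grad_var_def by (rule Ck_on_Suc_differentiable)
    qed
    then have flux_diff: "?flux differentiable (at x)"
      using D i by (intro differentiable_sum differentiable_scaleR) (auto simp: entries_differentiable_def)
    have "\<rho> i t y *\<^sub>R rel_velocity n b \<epsilon> (\<lambda>k. \<rho> k t y) (grad_var F \<rho> t y) i
        = - \<epsilon> *\<^sub>R ?flux y" for y
    proof -
      have "dim_col (?D y) = n"
        using D unfolding entries_differentiable_def by (blast dest: carrier_matD(2))
      then show ?thesis
        using mixture.density_rel_velocity[OF mix[OF t] i, of y \<epsilon> "grad_var F \<rho> t y"]
        by (simp only: mat_act_def)
    qed
    then show ?thesis
      by (simp only: divergence_scaleR[OF flux_diff])
  qed
  have "relative_velocity_system n b \<epsilon> F I \<rho> v \<longleftrightarrow> diffusion_system n b \<epsilon> F I \<rho> v"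
    unfolding relative_velocity_system_def diffusion_system_def
    by (simp only: flux_divergence cong: ball_cong imp_cong)
  with mixture.ex1_solves_rel_velocity[OF mix] mixture.invertible_tau_mat[OF mix]
  show ?thesis by blast
qed

end
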